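(* Over an alphabet containing at least three distinct characters, there exists an infinite family of strings $T$ of length $n$ (with $n$ and $\mathsf{e}(T)$ unbounded) such that, for a character $b \neq T[1]$ and $T' = b\,T[2..n]$, $\mathsf{e}(T') - \mathsf{e}(T) = \mathsf{e}(T) - 3$. Consequently the worst-case additive sensitivity of the CDAWG size under left-end substitution is at least $\mathsf{e}-3$.
   Context: Strings are finite sequences of characters from an alphabet $\Sigma$; $\varepsilon$ is the empty string, $T[i]$ is the $i$-th character and $T[i..j]=T[i]\cdots T[j]$. For a string $T$, $\mathrm{Substr}(T)$ is its set of substrings (including $\varepsilon$). A substring $u$ of $T$ is left-maximal in $T$ if $u$ is a prefix of $T$ or there are distinct characters $c \neq d$ with $cu, du \in \mathrm{Substr}(T)$; it is right-maximal in $T$ if $u$ is a suffix of $T$ or there are distinct characters $c\neq d$ with $uc, ud \in \mathrm{Substr}(T)$. $\mathsf{M}(T)$ is the set of substrings of $T$ that are both left- and right-maximal (it contains $\varepsilon$ and $T$). The compact directed acyclic word graph $\mathrm{CDAWG}(T)$ has exactly one node for each element of $\mathsf{M}(T)$, and the outgoing edges of the node $x$ are in bijection with the characters $c$ such that $xc \in \mathrm{Substr}(T)$. For a string $w$, $d_T(w)$ is the number of distinct characters $c$ with $wc \in \mathrm{Substr}(T)$. The size of the CDAWG is $\mathsf{e}(T) = \sum_{x \in \mathsf{M}(T)} d_T(x)$, its number of edges. *)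

theory Defs
  imports Main "HOL-Library.Sublist"
begin

definition Substr :: "'a list \<Rightarrow> 'a list set" where
  "Substr T = {u. sublist u T}"

definition left_maximal :: "'a list \<Rightarrow> 'a list \<Rightarrow> bool" where
  "left_maximal T u \<longleftrightarrow> u \<in> Substr T \<and>
     (prefix u T \<or> (\<exists>c d. c \<noteq> d \<and> c # u \<in> Substr T \<and> d # u \<in> Substr T))"

definition right_maximal :: "'a list \<Rightarrow> 'a list \<Rightarrow> bool" where
  "right_maximal T u \<longleftrightarrow> u \<in> Substr T \<and>
     (suffix u T \<or> (\<exists>c d. c \<noteq> d \<and> u @ [c] \<in> Substr T \<and> u @ [d] \<in> Substr T))"

definition maximal_substrs :: "'a list \<Rightarrow> 'a list set" where
  "maximal_substrs T = {u. left_maximal T u \<and> right_maximal T u}"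

definition right_degree :: "'a list \<Rightarrow> 'a list \<Rightarrow> nat" where
  "right_degree T w = card {c. w @ [c] \<in> Substr T}"

definition cdawg_size :: "'a list \<Rightarrow> nat" where
  "cdawg_size T = (\<Sum>x\<in>maximal_substrs T. right_degree T x)"

definition left_subst_increases :: "'a set \<Rightarrow> nat \<Rightarrow> int set" where
  "left_subst_increases \<Sigma> n =
     {int (cdawg_size (b # tl T)) - int (cdawg_size T) | T b.
        T \<in> lists \<Sigma> \<and> length T = n \<and> T \<noteq> [] \<and> b \<in> \<Sigma> \<and> b \<noteq> hd T}"

text \<open>Worst-case additive sensitivity: the largest increase of the CDAWG size over all strings
  of length \<open>n\<close> and all substitutions of their first character. The maximum is taken over a
  finite set even if the alphabet is infinite (lemma \<open>finite_left_subst_increases\<close>).\<close>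

definition left_subst_sensitivity :: "'a set \<Rightarrow> nat \<Rightarrow> int" where
  "left_subst_sensitivity \<Sigma> n = Max (left_subst_increases \<Sigma> n)"

lemma Substr_subset_image:
  "Substr T \<subseteq> (\<lambda>(i, j). take j (drop i T)) ` ({..length T} \<times> {..length T})"
proof
  fix u assume "u \<in> Substr T"
  then obtain p s where T: "T = p @ u @ s"
    by (auto simp: Substr_def sublist_def)
  then have "u = (\<lambda>(i, j). take j (drop i T)) (length p, length u)"
    by simp
  moreover have "(length p, length u) \<in> {..length T} \<times> {..length T}"
    using T by simp
  ultimately show "u \<in> (\<lambda>(i, j). take j (drop i T)) ` ({..length T} \<times> {..length T})"
    by (rule image_eqI)
qed

lemma finite_Substr: "finite (Substr T)"
  by (rule finite_subset[OF Substr_subset_image]) simp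

lemma card_Substr_le: "card (Substr T) \<le> (length T + 1) * (length T + 1)"
proof -
  have "card (Substr T) \<le> card ((\<lambda>(i, j). take j (drop i T)) ` ({..length T} \<times> {..length T}))"
    by (rule card_mono[OF _ Substr_subset_image]) simp
  also have "\<dots> \<le> card ({..length T} \<times> {..length T})"
    by (rule card_image_le) simp
  finally show ?thesis by (simp add: card_cartesian_product)
qed

lemma right_degree_le: "right_degree T w \<le> length T"
proof -
  have "{c. w @ [c] \<in> Substr T} \<subseteq> set T"
    by (auto simp: Substr_def dest!: set_mono_sublist)
  then have "card {c. w @ [c] \<in> Substr T} \<le> card (set T)"
    by (rule card_mono[OF finite_set])
  then show ?thesis
    unfolding right_degree_def using card_length[of T] by linarith
qed

lemma cdawg_size_le: "cdawg_size T \<le> (length T + 1) * (length T + 1) * length T"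
proof -
  have sub: "maximal_substrs T \<subseteq> Substr T"
    by (auto simp: maximal_substrs_def left_maximal_def)
  have "cdawg_size T \<le> card (maximal_substrs T) * length T"
    unfolding cdawg_size_def using sum_bounded_above[of "maximal_substrs T" "right_degree T" "length T"]
    by (simp add: right_degree_le)
  also have "\<dots> \<le> card (Substr T) * length T"
    by (rule mult_le_mono1[OF card_mono[OF finite_Substr sub]])
  also have "\<dots> \<le> (length T + 1) * (length T + 1) * length T"
    by (rule mult_le_mono1[OF card_Substr_le])
  finally show ?thesis .
qed

lemma finite_left_subst_increases:
  fixes \<Sigma> :: "'a set"
  shows "finite (left_subst_increases \<Sigma> n)"
proof (rule finite_subset)
  let ?B = "int ((n + 1) * (n + 1) * n)"
  show "left_subst_increases \<Sigma> n \<subseteq> {- ?B..?B}"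
  proof
    fix x assume "x \<in> left_subst_increases \<Sigma> n"
    then obtain T :: "'a list" and b where x: "x = int (cdawg_size (b # tl T)) - int (cdawg_size T)"
      and T: "length T = n" "T \<noteq> []"
      unfolding left_subst_increases_def by blast
    have "length (b # tl T) = n" using T by (cases T) auto
    then have "int (cdawg_size (b # tl T)) \<le> ?B" "int (cdawg_size T) \<le> ?B"
      using cdawg_size_le[of "b # tl T"] cdawg_size_le[of T] T(1) by (simp_all only: of_nat_le_iff)
    then show "x \<in> {- ?B..?B}" unfolding x by simp
  qed
qed simp

end

theory Submission
  imports Defs
begin

text \<open>
  The witnesses are \<open>T = (ab)\<^sup>m\<^sup>+\<^sup>1 c (ab)\<^sup>m\<close> with \<open>T' = bb(ab)\<^sup>m c (ab)\<^sup>m\<close>. Since \<open>c\<close> occurs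
  only once, every maximal substring other than the whole string avoids \<open>c\<close>, hence is essentially an
  alternating word, determined by its first letter and its length. In \<open>T\<close> these are the \<open>(ab)\<^sup>i\<close> with
  \<open>i \<le> m\<close>: the empty word has degree 3, the others have degree 2, and \<open>e(T) = 2m + 3\<close>. In \<open>T'\<close> the
  new left context \<open>bb\<close> makes the words \<open>b(ab)\<^sup>i\<close> with \<open>i < m\<close> maximal as well; here \<open>b\<close> and the
  empty word have degree 3, \<open>(ab)\<^sup>m\<close> has degree 1 and the others have degree 2, so
  \<open>e(T') = 4m + 3 = 2 e(T) - 3\<close>.
\<close>

section \<open>Substrings of a string with a character that occurs only once\<close>

text \<open>The \<open>c\<close> of any occurrence has to land on the only \<open>c\<close> of the
  string, so the occurrence has a single possible position.\<close>

lemma sublist_through_unique_char: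
  assumes "c \<notin> set X" "c \<notin> set Y"
  shows "sublist (p @ c # s) (X @ c # Y) \<longleftrightarrow> suffix p X \<and> prefix s Y"
proof -
  have "X @ c # Y = x @ (p @ c # s) @ y \<longleftrightarrow> X = x @ p \<and> Y = s @ y" for x y
    using append_Cons_eq_iff[of c X Y "x @ p" "s @ y"] assms by simp
  then show ?thesis
    by (auto simp: sublist_def suffix_def prefix_def)
qed

lemma sublist_avoiding_char:
  assumes "c \<notin> set u"
  shows "sublist u (X @ c # Y) \<longleftrightarrow> sublist u X \<or> sublist u Y"
  using assms by (auto simp: sublist_append sublist_Cons_right prefix_Cons)

lemma prefix_avoiding_char: "c \<notin> set u \<Longrightarrow> prefix u (X @ c # Y) \<longleftrightarrow> prefix u X"
  by (auto simp: prefix_append prefix_Cons)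

lemma suffix_avoiding_char: "c \<notin> set u \<Longrightarrow> suffix u (X @ c # Y) \<longleftrightarrow> suffix u Y"
  by (auto simp: suffix_append suffix_Cons)

text \<open>A substring containing \<open>c\<close> has only one occurrence, hence at most one left
  and one right neighbour. Left-maximality then forces it to reach the left end, and
  right-maximality the right end.\<close>

lemma maximal_through_unique_char:
  assumes c: "c \<notin> set X" "c \<notin> set Y" and "c \<in> set u"
    and max: "u \<in> maximal_substrs (X @ c # Y)"
  shows "u = X @ c # Y"
proof -
  obtain p s where u: "u = p @ c # s"
    using \<open>c \<in> set u\<close> by (meson split_list)
  note thr = sublist_through_unique_char[OF c]
  have "p = X"
  proof -
    consider "prefix u (X @ c # Y)"
      | d e where "d \<noteq> e" "sublist (d # u) (X @ c # Y)" "sublist (e # u) (X @ c # Y)"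
      using max by (auto simp: maximal_substrs_def left_maximal_def Substr_def)
    then show ?thesis
    proof cases
      case 1
      then obtain y where "X @ c # Y = p @ c # (s @ y)"
        unfolding u by (auto simp: prefix_def)
      then show ?thesis using append_Cons_eq_iff[of c X Y p "s @ y"] c by auto
    next
      case 2
      then have "suffix (d # p) X" "suffix (e # p) X"
        using thr[of "d # p" s] thr[of "e # p" s] by (auto simp: u)
      then have "d = e" by (auto simp: suffix_def)
      then show ?thesis using 2 by simp
    qed
  qed
  moreover have "s = Y"
  proof -
    consider "suffix u (X @ c # Y)"
      | d e where "d \<noteq> e" "sublist (u @ [d]) (X @ c # Y)" "sublist (u @ [e]) (X @ c # Y)"
      using max by (auto simp: maximal_substrs_def right_maximal_def Substr_def)
    then show ?thesis
    proof cases
      case 1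
      then obtain x where "X @ c # Y = (x @ p) @ c # s"
        unfolding u by (auto simp: suffix_def)
      then show ?thesis using append_Cons_eq_iff[of c X Y "x @ p" s] c by auto
    next
      case 2
      then have "prefix (s @ [d]) Y" "prefix (s @ [e]) Y"
        using thr[of p "s @ [d]"] thr[of p "s @ [e]"] by (auto simp: u)
      then have "d = e" by (auto simp: prefix_def)
      then show ?thesis using 2 by simp
    qed
  qed
  ultimately show ?thesis by (simp add: u)
qed

lemma self_maximal: "T \<in> maximal_substrs T"
  by (simp add: maximal_substrs_def left_maximal_def right_maximal_def Substr_def)

lemma right_degree_self: "right_degree T T = 0"
proof -
  have "{d. T @ [d] \<in> Substr T} = {}"
    by (auto simp: Substr_def dest: sublist_length_le)
  then show ?thesis by (simp add: right_degree_def)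
qed

section \<open>Alternating words and their one-letter extensions\<close>

text \<open>Swapping the two letters in the recursion lets one induction treat both starting
  letters. Even lengths give the powers of \<open>ab\<close>; odd lengths append one more
  \<open>a\<close>.\<close>

fun alt :: "'a \<Rightarrow> 'a \<Rightarrow> nat \<Rightarrow> 'a list" where
  "alt a b 0 = []"
| "alt a b (Suc n) = a # alt b a n"

lemma length_alt [simp]: "length (alt a b n) = n"
  by (induction a b n rule: alt.induct) auto

lemma set_alt: "set (alt a b n) \<subseteq> {a, b}"
  by (induction a b n rule: alt.induct) auto

lemma alt_snoc: "alt a b (Suc n) = alt a b n @ [if even n then a else b]"
  by (induction a b n rule: alt.induct) auto

lemma alt_inject: "alt a b k = alt a b j \<longleftrightarrow> k = j"
  by (metis length_alt)

lemma alt_swap_eq: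
  assumes "a \<noteq> b"
  shows "alt a b k = alt b a j \<longleftrightarrow> k = 0 \<and> j = 0"
  using assms by (cases k; cases j) auto

lemma prefix_alt_iff: "prefix u (alt a b n) \<longleftrightarrow> (\<exists>k\<le>n. u = alt a b k)"
proof (induction a b n arbitrary: u rule: alt.induct)
  case (2 a b n)
  show ?case
  proof (cases u)
    case (Cons x v)
    show ?thesis
    proof
      assume "prefix u (alt a b (Suc n))"
      then obtain k where "k \<le> n" "x = a" "v = alt b a k"
        using Cons 2 by auto
      then show "\<exists>k\<le>Suc n. u = alt a b k"
        using Cons by (intro exI[of _ "Suc k"]) simp
    next
      assume "\<exists>k\<le>Suc n. u = alt a b k"
      then obtain k where k: "k \<le> Suc n" "u = alt a b k" by blast
      with Cons obtain j where "k = Suc j" by (cases k) auto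
      then show "prefix u (alt a b (Suc n))" using k 2 by auto
    qed
  qed (auto intro: exI[of _ 0])
qed auto

text \<open>The starting position decides the first letter. The bound is strict for words starting
  with \<open>b\<close> because the initial \<open>a\<close> has to be skipped.\<close>

lemma sublist_alt_iff:
  "sublist u (alt a b n) \<longleftrightarrow> (\<exists>k\<le>n. u = alt a b k) \<or> (\<exists>k<n. u = alt b a k)"
proof (induction a b n rule: alt.induct)
  case (2 a b n)
  have "sublist u (alt a b (Suc n)) \<longleftrightarrow> (\<exists>k\<le>Suc n. u = alt a b k) \<or> sublist u (alt b a n)"
    using prefix_alt_iff[of u a b "Suc n"] by (simp add: sublist_Cons_right)
  then show ?case
    using 2 by (metis less_Suc_eq_le less_or_eq_imp_le nle_le not_less_eq_eq)
qed auto

lemma sublist_alt_alt: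
  assumes "a \<noteq> b"
  shows "sublist (alt a b k) (alt a b n) \<longleftrightarrow> k \<le> n"
    and "sublist (alt b a k) (alt a b n) \<longleftrightarrow> k < n \<or> k = 0"
  using assms by (auto simp: sublist_alt_iff alt_inject alt_swap_eq)

lemma suffix_alt_Suc:
  "suffix u (alt a b (Suc n)) \<longleftrightarrow> u = alt a b (Suc n) \<or> suffix u (alt b a n)"
  by (simp add: suffix_Cons)

text \<open>First letter and parity of the length determine the last letter, which a nonempty suffix
  must share. Both claims are proved together because the recursion exchanges the letters.\<close>

lemma suffix_alt_alt:
  assumes "a \<noteq> b"
  shows "suffix (alt a b k) (alt a b n) \<longleftrightarrow> k = 0 \<or> (k \<le> n \<and> (even k \<longleftrightarrow> even n))"
    and "suffix (alt b a k) (alt a b n) \<longleftrightarrow> k = 0 \<or> (k < n \<and> (even k \<longleftrightarrow> odd n))"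
  using assms
proof (induction a b n rule: alt.induct)
  case (1 a b)
  { case 1 show ?case by (cases k) auto
  next
    case 2 show ?case by (cases k) auto }
next
  case (2 a b n)
  { case 1 then show ?case
      using 2 by (auto simp: suffix_alt_Suc alt_inject le_Suc_eq simp del: alt.simps(2))
  next
    case 2 then show ?case
      using "2.IH" by (auto simp: suffix_alt_Suc alt_swap_eq le_less less_Suc_eq simp del: alt.simps(2)) }
qed

text \<open>Inside an alternating word the next letter is forced by parity. Only the empty word can
  be continued by either letter, whence \<open>k > 0\<close>.\<close>

lemma snoc_sublist_alt:
  assumes "a \<noteq> b" "k > 0"
  shows "sublist (alt a b k @ [d]) (alt a b n) \<longleftrightarrow> d = (if even k then a else b) \<and> k < n"
    and "sublist (alt b a k @ [d]) (alt a b n) \<longleftrightarrow> d = (if even k then b else a) \<and> Suc k < n"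
proof -
  have eq: "alt x y k @ [d] = alt x y j \<longleftrightarrow> j = Suc k \<and> d = (if even k then x else y)" for x y j
  proof
    assume A: "alt x y k @ [d] = alt x y j"
    then have "length (alt x y k @ [d]) = length (alt x y j)" by (rule arg_cong)
    then have "j = Suc k" by simp
    then show "j = Suc k \<and> d = (if even k then x else y)"
      using A by (simp only: alt_snoc) simp
  qed (simp only: alt_snoc)
  have neq: "alt x y k @ [d] \<noteq> alt y x j" if "x \<noteq> y" for x y j
    using that \<open>k > 0\<close> by (cases k; cases j) auto
  show "sublist (alt a b k @ [d]) (alt a b n) \<longleftrightarrow> d = (if even k then a else b) \<and> k < n"
    and "sublist (alt b a k @ [d]) (alt a b n) \<longleftrightarrow> d = (if even k then b else a) \<and> Suc k < n"
    using assms(1) by (auto simp: sublist_alt_iff eq neq)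
qed

lemma Cons_sublist_alt:
  assumes "a \<noteq> b" "k > 0"
  shows "sublist (d # alt a b k) (alt a b n) \<longleftrightarrow> d = b \<and> Suc k < n"
    and "sublist (d # alt b a k) (alt a b n) \<longleftrightarrow> d = a \<and> k < n"
proof -
  have eq: "d # alt x y k = alt y x j \<longleftrightarrow> j = Suc k \<and> d = y" for x y j
    by (cases j) (auto simp: alt_inject)
  have neq: "d # alt x y k \<noteq> alt x y j" if "x \<noteq> y" for x y j
    using that \<open>k > 0\<close> by (cases j) (auto simp: alt_swap_eq)
  show "sublist (d # alt a b k) (alt a b n) \<longleftrightarrow> d = b \<and> Suc k < n"
    and "sublist (d # alt b a k) (alt a b n) \<longleftrightarrow> d = a \<and> k < n"
    using assms(1) by (auto simp: sublist_alt_iff eq neq)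
qed

text \<open>A second right extension can come from \<open>c\<close>, exactly when the word ends the
  block before \<open>c\<close>; this is how branching enters the otherwise rigid alternating
  blocks.\<close>

lemma snoc_Substr_iff:
  assumes "c \<notin> set X" "c \<notin> set Y" "c \<notin> set u"
  shows "u @ [d] \<in> Substr (X @ c # Y) \<longleftrightarrow>
    (if d = c then suffix u X else sublist (u @ [d]) X \<or> sublist (u @ [d]) Y)"
  using assms sublist_through_unique_char[of c X Y u "[]"] sublist_avoiding_char[of c "u @ [d]" X Y]
  by (auto simp: Substr_def)

lemma Cons_Substr_iff:
  assumes "c \<notin> set X" "c \<notin> set Y" "c \<notin> set u"
  shows "d # u \<in> Substr (X @ c # Y) \<longleftrightarrow>
    (if d = c then prefix u Y else sublist (d # u) X \<or> sublist (d # u) Y)"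
  using assms sublist_through_unique_char[of c X Y "[]" u] sublist_avoiding_char[of c "d # u" X Y]
  by (auto simp: Substr_def)

text \<open>Splits off the only member through \<open>c\<close>, so that just the words avoiding
  \<open>c\<close> remain to be classified.\<close>

lemma maximal_substrs_unique_char:
  assumes "c \<notin> set X" "c \<notin> set Y"
  shows "maximal_substrs (X @ c # Y) =
    insert (X @ c # Y) {u \<in> maximal_substrs (X @ c # Y). c \<notin> set u}"
  using maximal_through_unique_char[OF assms] self_maximal by blast

section \<open>One-letter extensions in the two witness strings\<close>

context
  fixes a b c :: 'a and m :: nat
begin

text \<open>The blocks around \<open>c\<close>: \<open>lblock = (ab)\<^sup>m\<^sup>+\<^sup>1\<close>, \<open>lblock' = bb(ab)\<^sup>m\<close> and \<open>rblock = (ab)\<^sup>m\<close>.\<close>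

definition "lblock = alt a b (2 * m + 2)"
definition "lblock' = b # alt b a (2 * m + 1)"
definition "rblock = alt a b (2 * m)"

context
  assumes distinct: "a \<noteq> b" "a \<noteq> c" "b \<noteq> c" and m: "m > 0"
begin

lemma c_notin_alt: "c \<notin> set (alt a b k)" "c \<notin> set (alt b a k)"
  using set_alt[of a b k] set_alt[of b a k] distinct by auto

lemma c_notin: "c \<notin> set lblock" "c \<notin> set lblock'" "c \<notin> set rblock"
  unfolding lblock_def lblock'_def rblock_def using c_notin_alt distinct by auto

lemmas alt_facts = sublist_alt_alt suffix_alt_alt snoc_sublist_alt Cons_sublist_alt

lemma suffix_rblock:
  "suffix (alt a b k) rblock \<longleftrightarrow> k = 0 \<or> (k \<le> 2 * m \<and> even k)"
  "suffix (alt b a k) rblock \<longleftrightarrow> k = 0 \<or> (k < 2 * m \<and> odd k)"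
  using distinct by (simp_all add: rblock_def suffix_alt_alt)

text \<open>Two continuations, \<open>a\<close> and \<open>c\<close>, exist only for even
  \<open>k\<close>, which later excludes odd lengths.\<close>

lemma snoc_lblock:
  assumes "k > 0"
  shows "alt a b k @ [d] \<in> Substr (lblock @ c # rblock) \<longleftrightarrow>
      (d = a \<and> even k \<and> k < 2 * m + 2) \<or> (d = b \<and> odd k \<and> k < 2 * m + 2) \<or>
      (d = c \<and> even k \<and> k \<le> 2 * m + 2)"
  using assms distinct unfolding snoc_Substr_iff[OF c_notin(1,3) c_notin_alt(1)]
  unfolding lblock_def rblock_def
  by (auto simp: alt_facts simp del: alt.simps)

text \<open>Both blocks start with \<open>a\<close>, so neither \<open>c\<close> nor the left end
  ever precedes a nonempty word starting with \<open>b\<close>; its left neighbour is always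
  \<open>a\<close>.\<close>

lemma Cons_lblock:
  assumes "k > 0"
  shows "d # alt b a k \<in> Substr (lblock @ c # rblock) \<longleftrightarrow> d = a \<and> k < 2 * m + 2"
  using assms distinct unfolding Cons_Substr_iff[OF c_notin(1,3) c_notin_alt(2)]
  unfolding lblock_def rblock_def
  by (auto simp: alt_facts prefix_alt_iff alt_swap_eq simp del: alt.simps)

text \<open>A word starting with \<open>a\<close> cannot use the extra leading \<open>b\<close>, so
  only the alternating parts of the two blocks contribute.\<close>

lemma snoc_lblock'_a:
  assumes "k > 0"
  shows "alt a b k @ [d] \<in> Substr (lblock' @ c # rblock) \<longleftrightarrow>
      (d = a \<and> even k \<and> k < 2 * m) \<or> (d = b \<and> odd k \<and> k < 2 * m) \<or>
      (d = c \<and> even k \<and> k \<le> 2 * m)"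
proof -
  have "alt a b k = a # alt b a (k - 1)" using assms by (cases k) auto
  then have "\<not> prefix (alt a b k @ [d]) lblock'" "alt a b k \<noteq> lblock'"
    using distinct by (auto simp: lblock'_def)
  then show ?thesis
    using assms distinct unfolding snoc_Substr_iff[OF c_notin(2,3) c_notin_alt(1)]
    unfolding lblock'_def rblock_def sublist_Cons_right suffix_Cons
    by (auto simp: alt_facts simp del: alt.simps)
qed

text \<open>With \<open>k > 1\<close> the word starts with \<open>ba\<close> and cannot sit at the
  front of \<open>lblock'\<close>, which starts with \<open>bb\<close>. The single letter
  \<open>b\<close> does occur there and is treated in \<open>right_letters_b\<close>.\<close>

lemma snoc_lblock'_b:
  assumes "k > 1"
  shows "alt b a k @ [d] \<in> Substr (lblock' @ c # rblock) \<longleftrightarrow>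
      (d = b \<and> even k \<and> k \<le> 2 * m) \<or> (d = a \<and> odd k \<and> k \<le> 2 * m) \<or>
      (d = c \<and> odd k \<and> k \<le> 2 * m + 1)"
proof -
  have "alt b a k = b # a # alt b a (k - 2)"
    using assms by (cases k; cases "k - 1") auto
  then have "\<not> prefix (alt b a k @ [d]) lblock'" "alt b a k \<noteq> lblock'"
    using distinct by (auto simp: lblock'_def)
  then show ?thesis
    using assms distinct unfolding snoc_Substr_iff[OF c_notin(2,3) c_notin_alt(2)]
    unfolding lblock'_def rblock_def sublist_Cons_right suffix_Cons
    by (auto simp: alt_facts simp del: alt.simps)
qed

lemma Cons_lblock'_a:
  assumes "k > 0"
  shows "d # alt a b k \<in> Substr (lblock' @ c # rblock) \<longleftrightarrow> (d = b \<or> d = c) \<and> k \<le> 2 * m"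
proof -
  have "alt a b k = a # alt b a (k - 1)" using assms by (cases k) auto
  then have "\<not> prefix (d # alt a b k) lblock'"
    using distinct by (auto simp: lblock'_def)
  then show ?thesis
    using assms distinct unfolding Cons_Substr_iff[OF c_notin(2,3) c_notin_alt(1)]
    unfolding lblock'_def rblock_def sublist_Cons_right
    by (auto simp: alt_facts prefix_alt_iff alt_inject simp del: alt.simps)
qed

text \<open>The source of the additional nodes: the leading \<open>bb\<close> supplies the left
  neighbour \<open>b\<close> besides the usual \<open>a\<close>. Both are available exactly for
  \<open>k < 2 * m\<close>.\<close>

lemma Cons_lblock'_b:
  assumes "k > 0"
  shows "d # alt b a k \<in> Substr (lblock' @ c # rblock) \<longleftrightarrow> (d = a \<and> k < 2 * m) \<or> (d = b \<and> k \<le> 2 * m + 1)"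
proof -
  have "prefix (d # alt b a k) lblock' \<longleftrightarrow> d = b \<and> k \<le> 2 * m + 1"
    by (auto simp: lblock'_def prefix_alt_iff alt_inject simp del: alt.simps)
  then show ?thesis
    using assms distinct unfolding Cons_Substr_iff[OF c_notin(2,3) c_notin_alt(2)]
    unfolding lblock'_def rblock_def sublist_Cons_right
    by (auto simp: alt_facts prefix_alt_iff alt_swap_eq simp del: alt.simps)
qed

lemma right_letters_Nil:
  "{d. [] @ [d] \<in> Substr (lblock @ c # rblock)} = {a, b, c}"
  "{d. [] @ [d] \<in> Substr (lblock' @ c # rblock)} = {a, b, c}"
proof -
  have single: "sublist [d] xs \<longleftrightarrow> d \<in> set xs" for d :: 'a and xs
    by (auto simp: sublist_def in_set_conv_decomp)
  have "set lblock = {a, b}" "set lblock' = {a, b}" "set rblock \<subseteq> {a, b}"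
    using set_alt[of a b "2 * m"] set_alt[of b a "2 * m - 1"] m
    by (auto simp: lblock_def lblock'_def rblock_def gr0_conv_Suc)
  then show "{d. [] @ [d] \<in> Substr (lblock @ c # rblock)} = {a, b, c}"
    "{d. [] @ [d] \<in> Substr (lblock' @ c # rblock)} = {a, b, c}"
    by (auto simp: Substr_def single)
qed

section \<open>Nodes and edges before the substitution\<close>

text \<open>Each power listed is a prefix of the left block and a suffix of the right one.
  Conversely, right-maximality fixes the parity and left-maximality rules out words starting with
  \<open>b\<close>.\<close>

lemma avoiding_maximal_lblock:
  "{u \<in> maximal_substrs (lblock @ c # rblock). c \<notin> set u} = (\<lambda>i. alt a b (2 * i)) ` {..m}"
proof (intro equalityI subsetI)
  fix u assume "u \<in> {u \<in> maximal_substrs (lblock @ c # rblock). c \<notin> set u}"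
  then have cu: "c \<notin> set u" and lm: "left_maximal (lblock @ c # rblock) u" and rm: "right_maximal (lblock @ c # rblock) u"
    by (auto simp: maximal_substrs_def)
  have "sublist u lblock \<or> sublist u rblock"
    using lm sublist_avoiding_char[OF cu] by (auto simp: left_maximal_def Substr_def)
  then consider k where "u = alt a b k" "k > 0" | k where "u = alt b a k" "k > 0" | "u = []"
    unfolding lblock_def rblock_def sublist_alt_iff by (metis alt.simps(1) not_gr_zero)
  then show "u \<in> (\<lambda>i. alt a b (2 * i)) ` {..m}"
  proof cases
    case (1 k)
    have "k \<le> 2 * m \<and> even k"
    proof -
      have "suffix u rblock \<or> (\<exists>d e. d \<noteq> e \<and> u @ [d] \<in> Substr (lblock @ c # rblock) \<and> u @ [e] \<in> Substr (lblock @ c # rblock))"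
        using rm suffix_avoiding_char[OF cu] by (auto simp: right_maximal_def)
      then show ?thesis
      proof
        assume "suffix u rblock"
        then show ?thesis using 1 distinct by (auto simp: rblock_def suffix_alt_alt)
      next
        assume "\<exists>d e. d \<noteq> e \<and> u @ [d] \<in> Substr (lblock @ c # rblock) \<and> u @ [e] \<in> Substr (lblock @ c # rblock)"
        then have "even k \<and> k < 2 * m + 2"
          using 1 by (auto simp: snoc_lblock)
        \<comment> \<open>Parity sharpens \<open>k < 2 * m + 2\<close> to
          \<open>k \<le> 2 * m\<close>.\<close>
        then show ?thesis by presburger
      qed
    qed
    then show ?thesis using 1 by (auto elim!: evenE)
  next
    case (2 k)
    have "prefix u lblock \<or> (\<exists>d e. d \<noteq> e \<and> d # u \<in> Substr (lblock @ c # rblock) \<and> e # u \<in> Substr (lblock @ c # rblock))"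
      using lm prefix_avoiding_char[OF cu] by (auto simp: left_maximal_def)
    \<comment> \<open>\<open>lblock\<close> is unfolded only under \<open>prefix\<close>, so that
      \<open>Cons_lblock\<close> still matches the remaining occurrences.\<close>
    then have False
      using 2 distinct Cons_lblock[of k] unfolding lblock_def[THEN arg_cong[of _ _ "prefix u"]]
      by (auto simp: prefix_alt_iff alt_swap_eq simp del: alt.simps)
    then show ?thesis ..
  next
    case 3
    then show ?thesis by (auto intro!: image_eqI[of _ _ 0])
  qed
next
  fix u assume "u \<in> (\<lambda>i. alt a b (2 * i)) ` {..m}"
  then obtain i where u: "u = alt a b (2 * i)" and i: "i \<le> m" by auto
  have "prefix u lblock" unfolding u lblock_def prefix_alt_iff using i by (intro exI[of _ "2 * i"]) auto
  moreover have "suffix u rblock" using i distinct by (auto simp: u rblock_def suffix_alt_alt)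
  moreover have "c \<notin> set u" by (simp add: u c_notin_alt)
  ultimately show "u \<in> {u \<in> maximal_substrs (lblock @ c # rblock). c \<notin> set u}"
    by (auto simp: maximal_substrs_def left_maximal_def right_maximal_def Substr_def
        prefix_avoiding_char suffix_avoiding_char)
qed

lemma cdawg_size_lblock: "cdawg_size (lblock @ c # rblock) = 2 * m + 3"
proof -
  let ?T = "lblock @ c # rblock"
  have deg: "right_degree ?T (alt a b (2 * i)) = (if i = 0 then 3 else 2)" if "i \<le> m" for i
  proof (cases "i = 0")
    case True
    have "right_degree ?T [] = card {a, b, c}"
      unfolding right_degree_def using right_letters_Nil(1) by (rule arg_cong)
    then show ?thesis using True distinct by simp
  next
    case False
    then have "{d. alt a b (2 * i) @ [d] \<in> Substr ?T} = {a, c}"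
      using that by (auto simp: snoc_lblock)
    then show ?thesis using False distinct by (simp add: right_degree_def)
  qed
  have inj: "inj_on (\<lambda>i. alt a b (2 * i)) {..m}"
    by (auto simp: inj_on_def alt_inject)
  \<comment> \<open>The image consists of words avoiding \<open>c\<close>, while \<open>?T\<close>
    contains it. Being a new element of degree 0, \<open>?T\<close> drops out of the sum.\<close>
  have "?T \<notin> (\<lambda>i. alt a b (2 * i)) ` {..m}"
    unfolding avoiding_maximal_lblock[symmetric] by simp
  moreover have "maximal_substrs ?T = insert ?T ((\<lambda>i. alt a b (2 * i)) ` {..m})"
    using maximal_substrs_unique_char[OF c_notin(1,3)] by (simp only: avoiding_maximal_lblock)
  ultimately have "cdawg_size ?T = (\<Sum>i\<le>m. right_degree ?T (alt a b (2 * i)))"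
    by (simp add: cdawg_size_def right_degree_self sum.reindex[OF inj])
  also have "\<dots> = (\<Sum>i\<le>m. 2 + (if i = 0 then 1 else 0))"
    by (rule sum.cong) (auto simp: deg)
  also have "\<dots> = 2 * m + 3"
    unfolding sum.distrib by simp
  finally show ?thesis .
qed

section \<open>Nodes and edges after the substitution\<close>

lemma right_letters_b: "{d. [b] @ [d] \<in> Substr (lblock' @ c # rblock)} = {a, b, c}"
proof -
  have b: "alt b a 1 = [b]" by simp
  have "[b] @ [d] \<in> Substr (lblock' @ c # rblock)" if "d \<in> {a, b}" for d
    using that Cons_lblock'_a[of 1 b] Cons_lblock'_b[of 1 b] m by (auto simp: Substr_def)
  moreover have "[b] @ [c] \<in> Substr (lblock' @ c # rblock)"
  proof -
    have "suffix (alt b a 1) (alt b a (2 * m + 1))"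
      using distinct by (subst suffix_alt_alt) auto
    then have "suffix [b] lblock'" unfolding lblock'_def b by (rule suffix_ConsI)
    then show ?thesis using snoc_Substr_iff[of c lblock' rblock "[b]" c] c_notin distinct by simp
  qed
  moreover have "d \<in> {a, b, c}" if "[b] @ [d] \<in> Substr (lblock' @ c # rblock)" for d
  proof -
    have "set ([b] @ [d]) \<subseteq> set (lblock' @ c # rblock)"
      using that unfolding Substr_def by (blast dest: set_mono_sublist)
    then show ?thesis
      using set_alt[of a b "2 * m"] set_alt[of b a "2 * m + 1"] by (auto simp: lblock'_def rblock_def)
  qed
  ultimately show ?thesis by blast
qed

text \<open>Words containing \<open>bb\<close> never branch to the right. For the alternating ones
  parity comes from right-maximality, and the bound on words starting with \<open>b\<close> from
  left-maximality.\<close>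

lemma avoiding_maximal_lblock':
  "{u \<in> maximal_substrs (lblock' @ c # rblock). c \<notin> set u} =
    (\<lambda>i. alt a b (2 * i)) ` {..m} \<union> (\<lambda>i. alt b a (2 * i + 1)) ` {..<m}"
proof (intro equalityI subsetI)
  let ?T = "lblock' @ c # rblock"
  fix u assume "u \<in> {u \<in> maximal_substrs ?T. c \<notin> set u}"
  then have cu: "c \<notin> set u" and lm: "left_maximal ?T u" and rm: "right_maximal ?T u"
    by (auto simp: maximal_substrs_def)
  have rm': "suffix u rblock \<or> (\<exists>d e. d \<noteq> e \<and> u @ [d] \<in> Substr ?T \<and> u @ [e] \<in> Substr ?T)"
    using rm suffix_avoiding_char[OF cu] by (auto simp: right_maximal_def)
  have lm': "prefix u lblock' \<or> (\<exists>d e. d \<noteq> e \<and> d # u \<in> Substr ?T \<and> e # u \<in> Substr ?T)"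
    using lm prefix_avoiding_char[OF cu] by (auto simp: left_maximal_def)
  have "sublist u lblock' \<or> sublist u rblock"
    using lm sublist_avoiding_char[OF cu] by (auto simp: left_maximal_def Substr_def)
  then have "(\<exists>k\<le>2 * m + 1. u = b # alt b a k) \<or> (\<exists>k. u = alt a b k) \<or> (\<exists>k. u = alt b a k)"
    unfolding lblock'_def rblock_def sublist_Cons_right prefix_Cons sublist_alt_iff prefix_alt_iff
    by (metis alt.simps(1))
  \<comment> \<open>All candidates not starting with \<open>bb\<close> are alternating.
    \<open>[b]\<close> and \<open>[]\<close> are set apart because the extension lemmas assume
    \<open>k > 1\<close> or \<open>k > 0\<close>.\<close>
  then consider k where "u = b # alt b a k" "0 < k" "k \<le> 2 * m + 1" | k where "u = alt a b k" "k > 0"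
    | k where "u = alt b a k" "k > 1" | "u = [b]" | "u = []"
    by (metis One_nat_def alt.simps gr0I less_one linorder_neqE_nat)
  then show "u \<in> (\<lambda>i. alt a b (2 * i)) ` {..m} \<union> (\<lambda>i. alt b a (2 * i + 1)) ` {..<m}"
  proof cases
    case (1 k)
    obtain j where j: "k = Suc j" using \<open>k > 0\<close> gr0_conv_Suc by blast
    \<comment> \<open>An alternating word has no factor \<open>bb\<close>. Written as
      \<open>b # alt b a 1\<close>, that factor falls under \<open>Cons_sublist_alt\<close>, which
      admits only the opposite letter in front.\<close>
    have no: "\<not> sublist (b # b # v) (alt x y n)" if "{x, y} = {a, b}" for v x y n
    proof
      assume A: "sublist (b # b # v) (alt x y n)"
      have "sublist (b # alt b a 1) (b # b # v)" by (simp add: sublist_Cons_right)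
      then have "sublist (b # alt b a 1) (alt x y n)" using A by (rule sublist_order.order_trans)
      then show False using that distinct Cons_sublist_alt(1)[of b a 1 b n] Cons_sublist_alt(2)[of a b 1 b n]
        by (auto simp: doubleton_eq_iff simp del: alt.simps)
    qed
    have u: "u = b # b # alt a b j" using 1 j by simp
    have "\<not> suffix u rblock"
      using no[of a b] by (auto simp: rblock_def u dest: suffix_imp_sublist)
    \<comment> \<open>The word occurs only at the front of \<open>lblock'\<close>, so its
      continuation is unique: the next alternating letter, or \<open>c\<close> once the block is
      exhausted.\<close>
    moreover have "d = (if even k then b else a) \<and> k < 2 * m + 1 \<or> d = c \<and> k = 2 * m + 1"
      if "u @ [d] \<in> Substr ?T" for d
    proof (cases "d = c")
      case True
      then have "suffix u lblock'" using that snoc_Substr_iff[OF c_notin(2,3) cu] by simp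
      then have "u = lblock'"
        using no[of b a] by (auto simp: lblock'_def u suffix_Cons insert_commute simp del: alt.simps
            dest: suffix_imp_sublist)
      then show ?thesis using True 1 by (simp add: lblock'_def alt_inject del: alt.simps)
    next
      case False
      then have "prefix (u @ [d]) lblock'"
        using that snoc_Substr_iff[OF c_notin(2,3) cu] no[of b a] no[of a b "alt a b j @ [d]"]
        by (auto simp: u lblock'_def[THEN arg_cong[of _ _ "sublist v" for v]] rblock_def
            sublist_Cons_right[of _ b] insert_commute lblock'_def simp del: alt.simps)
      then have "prefix (alt b a k @ [d]) (alt b a (2 * m + 1))" using 1 by (simp add: lblock'_def del: alt.simps)
      then have "sublist (alt b a k @ [d]) (alt b a (2 * m + 1))" by (rule prefix_imp_sublist)
      then show ?thesis using distinct \<open>k > 0\<close> by (simp add: snoc_sublist_alt del: alt.simps)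
    qed
    ultimately have False using rm' by (metis less_irrefl)
    then show ?thesis ..
  next
    case (2 k)
    have "k \<le> 2 * m \<and> even k"
      using rm' 2 distinct by (auto simp: suffix_rblock snoc_lblock'_a)
    then show ?thesis using 2 by (auto elim!: evenE)
  next
    case (3 k)
    have "odd k"
      using rm' 3 distinct by (auto simp: suffix_rblock snoc_lblock'_b)
    \<comment> \<open>Starting with \<open>ba\<close>, the word is no prefix, so it needs both left
      neighbours \<open>a\<close> and \<open>b\<close>.\<close>
    moreover have "k < 2 * m"
    proof -
      have "alt b a k = b # a # alt b a (k - 2)"
        using 3 by (cases k; cases "k - 1") auto
      then have "\<not> prefix u lblock'" using 3 distinct by (auto simp: lblock'_def)
      then show ?thesis using lm' 3 by (auto simp: Cons_lblock'_b)
    qed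
    ultimately show ?thesis using 3 by (auto elim!: oddE simp del: alt.simps)
  next
    case 4
    \<comment> \<open>This is the index 0 of the second family, which is nonempty because
      \<open>m > 0\<close>.\<close>
    then have "u = alt b a (2 * 0 + 1)" by simp
    then show ?thesis using m by blast
  next
    case 5
    then show ?thesis by (auto intro!: image_eqI[of _ _ 0])
  qed
next
  let ?T = "lblock' @ c # rblock"
  fix u assume "u \<in> (\<lambda>i. alt a b (2 * i)) ` {..m} \<union> (\<lambda>i. alt b a (2 * i + 1)) ` {..<m}"
  then consider i where "u = alt a b (2 * i)" "0 < i" "i \<le> m" | "u = []"
    | i where "u = alt b a (2 * i + 1)" "i < m"
    by (auto simp del: alt.simps) (metis alt.simps(1) gr0I mult_0_right)
  then show "u \<in> {u \<in> maximal_substrs ?T. c \<notin> set u}"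
  proof cases
    case (1 i)
    \<comment> \<open>These words are no longer prefixes; left-maximality now comes from
      \<open>b\<close> inside \<open>lblock'\<close> and from \<open>c\<close> in front of
      \<open>rblock\<close>.\<close>
    have "b # u \<in> Substr ?T" "c # u \<in> Substr ?T"
      using 1 by (auto simp: Cons_lblock'_a)
    moreover have "suffix u ?T"
      using 1 distinct c_notin_alt by (simp add: rblock_def suffix_alt_alt suffix_avoiding_char)
    moreover have "c \<notin> set u" using 1 c_notin_alt by simp
    ultimately show ?thesis using distinct
      by (auto simp: maximal_substrs_def left_maximal_def right_maximal_def Substr_def)
  next
    case 2
    then show ?thesis
      by (auto simp: maximal_substrs_def left_maximal_def right_maximal_def Substr_def)
  next
    case (3 i)
    have "a # u \<in> Substr ?T" "b # u \<in> Substr ?T"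
      using 3 by (auto simp: Cons_lblock'_b simp del: alt.simps)
    moreover have "suffix u ?T"
      using 3 distinct c_notin_alt by (simp add: rblock_def suffix_alt_alt suffix_avoiding_char del: alt.simps)
    moreover have "c \<notin> set u" using 3 c_notin_alt by (simp del: alt.simps)
    ultimately show ?thesis using distinct
      by (auto simp: maximal_substrs_def left_maximal_def right_maximal_def Substr_def)
  qed
qed

text \<open>The words starting with \<open>a\<close>, with the empty word, contribute
  \<open>2 * m + 2\<close>; those starting with \<open>b\<close> contribute
  \<open>2 * m + 1\<close>.\<close>

lemma cdawg_size_lblock': "cdawg_size (lblock' @ c # rblock) = 4 * m + 3"
proof -
  let ?T = "lblock' @ c # rblock"
  let ?A = "(\<lambda>i. alt a b (2 * i)) ` {..m}" and ?B = "(\<lambda>i. alt b a (2 * i + 1)) ` {..<m}"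
  have deg_Nil: "right_degree ?T [] = 3"
  proof -
    have "right_degree ?T [] = card {a, b, c}"
      unfolding right_degree_def using right_letters_Nil(2) by (rule arg_cong)
    then show ?thesis using distinct by simp
  qed
  have degA: "right_degree ?T (alt a b (2 * i)) = 2 + (if i = 0 then 1 else 0)" if "i < m" for i
  proof (cases "i = 0")
    case False
    then have "{d. alt a b (2 * i) @ [d] \<in> Substr ?T} = {a, c}"
      using that by (auto simp: snoc_lblock'_a)
    then show ?thesis using False distinct by (simp add: right_degree_def)
  qed (simp add: deg_Nil)
  \<comment> \<open>This word occurs only at the ends of the two blocks, followed once by
    \<open>c\<close> and once by nothing, so it loses the edge labelled \<open>a\<close>.\<close>
  have degAm: "right_degree ?T (alt a b (2 * m)) = 1"
  proof -
    have "{d. alt a b (2 * m) @ [d] \<in> Substr ?T} = {c}"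
      using m by (auto simp: snoc_lblock'_a)
    then show ?thesis by (simp add: right_degree_def)
  qed
  have degB: "right_degree ?T (alt b a (2 * i + 1)) = 2 + (if i = 0 then 1 else 0)" if "i < m" for i
  proof (cases "i = 0")
    case True
    have "right_degree ?T [b] = card {a, b, c}"
      unfolding right_degree_def using right_letters_b by (rule arg_cong)
    then show ?thesis using True distinct by simp
  next
    case False
    then have "{d. alt b a (2 * i + 1) @ [d] \<in> Substr ?T} = {a, c}"
      using that snoc_lblock'_b[of "2 * i + 1"] by (auto simp del: alt.simps)
    then show ?thesis using False distinct by (simp add: right_degree_def)
  qed
  have inj: "inj_on (\<lambda>i. alt a b (2 * i)) {..m}" "inj_on (\<lambda>i. alt b a (2 * i + 1)) {..<m}"
    by (auto simp: inj_on_def alt_inject simp del: alt.simps)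
  have disj: "?A \<inter> ?B = {}"
    using distinct by (auto simp: alt_swap_eq simp del: alt.simps)
  have part: "(\<Sum>i<m. 2 + (if i = 0 then 1 else 0)) = 2 * m + 1"
    using m unfolding sum.distrib by simp
  have A: "(\<Sum>i\<le>m. right_degree ?T (alt a b (2 * i))) = 2 * m + 2"
  proof -
    have "(\<Sum>i<m. right_degree ?T (alt a b (2 * i))) = 2 * m + 1"
      unfolding part[symmetric] by (rule sum.cong) (simp_all add: degA)
    then show ?thesis by (simp add: lessThan_Suc_atMost[symmetric] degAm)
  qed
  have B: "(\<Sum>i<m. right_degree ?T (alt b a (2 * i + 1))) = 2 * m + 1"
    unfolding part[symmetric] by (rule sum.cong) (simp_all only: degB lessThan_iff)
  have "?T \<notin> ?A \<union> ?B"
    unfolding avoiding_maximal_lblock'[symmetric] by simp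
  moreover have "maximal_substrs ?T = insert ?T (?A \<union> ?B)"
    using maximal_substrs_unique_char[OF c_notin(2,3)] by (simp only: avoiding_maximal_lblock')
  ultimately have "cdawg_size ?T = sum (right_degree ?T) (?A \<union> ?B)"
    by (simp add: cdawg_size_def right_degree_self del: alt.simps)
  also have "\<dots> = sum (right_degree ?T) ?A + sum (right_degree ?T) ?B"
    by (rule sum.union_disjoint) (use disj in auto)
  also have "\<dots> = 4 * m + 3"
    unfolding sum.reindex[OF inj(1)] sum.reindex[OF inj(2)] comp_def A B by simp
  finally show ?thesis .
qed

end

end

section \<open>The infinite family and the sensitivity bound\<close>

theorem theorem6:
  fixes \<Sigma> :: "'a set"
  assumes "\<exists>x\<in>\<Sigma>. \<exists>y\<in>\<Sigma>. \<exists>z\<in>\<Sigma>. x \<noteq> y \<and> x \<noteq> z \<and> y \<noteq> z"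
  shows "\<exists>F \<subseteq> lists \<Sigma>. infinite F
           \<and> \<not> bdd_above (length ` F)
           \<and> \<not> bdd_above (cdawg_size ` F)
           \<and> (\<forall>T\<in>F. T \<noteq> []
                \<and> (\<exists>b\<in>\<Sigma>. b \<noteq> hd T
                     \<and> int (cdawg_size (b # tl T)) - int (cdawg_size T) = int (cdawg_size T) - 3)
                \<and> left_subst_sensitivity \<Sigma> (length T) \<ge> int (cdawg_size T) - 3)"
proof -
  obtain a b c where abc: "a \<in> \<Sigma>" "b \<in> \<Sigma>" "c \<in> \<Sigma>" and ne: "a \<noteq> b" "a \<noteq> c" "b \<noteq> c"
    using assms by blast
  define T where "T m = lblock a b m @ c # rblock a b m" for m
  \<comment> \<open>Index 0 is left out: \<open>abc\<close> has size 3 but \<open>bbc\<close> has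
    size 4, so the required equality fails there.\<close>
  define F where "F = T ` {0<..}"
  have size: "cdawg_size (T m) = 2 * m + 3" if "m > 0" for m
    using cdawg_size_lblock[OF ne that] by (simp add: T_def)
  \<comment> \<open>Exposes the first letter: replacing it by \<open>b\<close> turns the left block
    into \<open>lblock'\<close>.\<close>
  have T_eq: "T m = a # b # alt a b (2 * m) @ c # rblock a b m" for m
    by (simp add: T_def lblock_def)
  have size': "cdawg_size (b # tl (T m)) = 4 * m + 3" if "m > 0" for m
    using cdawg_size_lblock'[OF ne that] by (simp add: T_eq lblock'_def)
  have len: "length (T m) = 4 * m + 3" for m
    by (simp add: T_def lblock_def rblock_def)
  have lists: "T m \<in> lists \<Sigma>" for m
    using set_alt[of a b "2 * m + 2"] set_alt[of a b "2 * m"] abc by (auto simp: T_def lblock_def rblock_def)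
  have unbounded: "\<not> bdd_above (f ` F)" if "\<And>m. m > 0 \<Longrightarrow> f (T m) > m" for f :: "'a list \<Rightarrow> nat"
  proof
    assume "bdd_above (f ` F)"
    then obtain B where "\<And>m. m > 0 \<Longrightarrow> f (T m) \<le> B"
      by (auto simp: bdd_above_def F_def)
    from this[of "Suc B"] that[of "Suc B"] show False by simp
  qed
  have ub_len: "\<not> bdd_above (length ` F)" by (rule unbounded) (simp add: len)
  have ub_size: "\<not> bdd_above (cdawg_size ` F)" by (rule unbounded) (simp add: size)
  have "infinite F" using ub_len by auto
  moreover have "\<forall>U\<in>F. U \<noteq> [] \<and> (\<exists>b\<in>\<Sigma>. b \<noteq> hd U
        \<and> int (cdawg_size (b # tl U)) - int (cdawg_size U) = int (cdawg_size U) - 3)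
      \<and> left_subst_sensitivity \<Sigma> (length U) \<ge> int (cdawg_size U) - 3"
  proof
    fix U assume "U \<in> F"
    obtain m where m: "m > 0" and U: "U = T m" using \<open>U \<in> F\<close> by (auto simp: F_def)
    have ne_hd: "U \<noteq> []" "b \<noteq> hd U" using ne by (simp_all add: U T_eq)
    have eq: "int (cdawg_size (b # tl U)) - int (cdawg_size U) = int (cdawg_size U) - 3"
      using m by (simp add: U size size')
    \<comment> \<open>Sensitivity is a maximum over a finite set, so membership of this one increase
      yields the lower bound.\<close>
    have "int (cdawg_size (b # tl U)) - int (cdawg_size U) \<in> left_subst_increases \<Sigma> (length U)"
      unfolding left_subst_increases_def using ne_hd abc lists U by blast
    then have "left_subst_sensitivity \<Sigma> (length U) \<ge> int (cdawg_size U) - 3"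
      unfolding left_subst_sensitivity_def eq by (rule Max_ge[OF finite_left_subst_increases])
    then show "U \<noteq> [] \<and> (\<exists>b\<in>\<Sigma>. b \<noteq> hd U
        \<and> int (cdawg_size (b # tl U)) - int (cdawg_size U) = int (cdawg_size U) - 3)
      \<and> left_subst_sensitivity \<Sigma> (length U) \<ge> int (cdawg_size U) - 3"
      using ne_hd eq abc by blast
  qed
  moreover have "F \<subseteq> lists \<Sigma>" using lists by (auto simp: F_def)
  ultimately show ?thesis
    using ub_len ub_size by (intro exI[of _ F] conjI)
qed

end
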